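(* For any positive integer $n$, the cycle graph $C_n$ on $n$ vertices satisfies $$\rho_1(C_n)-\rho_2(C_n)\ <\ \frac{1}{n-1}\left\lfloor \frac{n^2}{4}\right\rfloor .$$
   Context: All graphs are finite, undirected, simple and connected. The distance matrix $\mathcal{D}(G)$ of a connected graph $G$ on vertices $1,\dots,n$ is the $n\times n$ matrix whose $(i,j)$ entry is the length of a shortest path from $i$ to $j$. A real number $\lambda$ is a Pareto eigenvalue of a real $n\times n$ matrix $A$ if there is a nonzero vector $\mathbf{x}\in\mathbb{R}^n$, $\mathbf{x}\ge 0$ (entrywise), with $A\mathbf{x}\ge\lambda\mathbf{x}$ (entrywise) and $\lambda=\frac{\mathbf{x}^TA\mathbf{x}}{\mathbf{x}^T\mathbf{x}}$. The distance Pareto eigenvalues of $G$ are the Pareto eigenvalues of $\mathcal{D}(G)$. $\rho_k(G)$ denotes the $k$-th largest element of the set of distinct distance Pareto eigenvalues of $G$.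
   Formalization: The claim is proved for n ≥ 4 only: for n = 3 both sides equal 1, so the strict inequality fails; for n = 1 the bound divides by zero and ρ_2 does not exist; for n = 2 there is no simple cycle (and K_2 gives equality). *)

theory Defs
  imports
    Complex_Main
    "Jordan_Normal_Form.Matrix"
    "Graph_Theory.Graph_Theory"
begin

text \<open>Vertices are numbered from 0. Undirected graphs are symmetric digraphs, as usual in
  \<^theory>\<open>Graph_Theory.Digraph\<close>; each edge is represented by its two arcs. The definition is
  meant for \<open>3 \<le> n\<close> (see \<open>graph_cycle_graph\<close> below).\<close>

definition cycle_graph :: "nat \<Rightarrow> nat pair_pre_digraph" where
  "cycle_graph n = \<lparr> pverts = {0..<n},
     parcs = {(i, j). i < n \<and> j < n \<and> (j = (i + 1) mod n \<or> i = (j + 1) mod n)} \<rparr>"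

text \<open>Shortest paths with unit arc weights. Meant for connected graphs only
  (\<open>real_of_ereal \<infinity> = 0\<close>).\<close>

definition graph_dist :: "('a, 'b) pre_digraph \<Rightarrow> 'a \<Rightarrow> 'a \<Rightarrow> real" where
  "graph_dist G u v = real_of_ereal (wf_digraph.\<mu> G (\<lambda>_. 1) u v)"

text \<open>Meant for graphs with vertex set \<open>{0..<n}\<close>.\<close>

definition distance_matrix :: "(nat, 'b) pre_digraph \<Rightarrow> real mat" where
  "distance_matrix G =
     mat (card (verts G)) (card (verts G)) (\<lambda>(i, j). graph_dist G i j)"

definition pareto_eigenvalue :: "real mat \<Rightarrow> real \<Rightarrow> bool" where
  "pareto_eigenvalue A l \<longleftrightarrow>
     (\<exists>x \<in> carrier_vec (dim_row A). x \<noteq> 0\<^sub>v (dim_row A) \<and> 0\<^sub>v (dim_row A) \<le> x \<and>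
        l \<cdot>\<^sub>v x \<le> A *\<^sub>v x \<and> l = (x \<bullet> (A *\<^sub>v x)) / (x \<bullet> x))"

definition distance_pareto_eigenvalues :: "(nat, 'b) pre_digraph \<Rightarrow> real set" where
  "distance_pareto_eigenvalues G = {l. pareto_eigenvalue (distance_matrix G) l}"

text \<open>\<open>kth_largest 1 S\<close> is the largest element. For \<open>k \<ge> 1\<close> at most one \<open>r\<close> has the stated
  property, since \<open>card\<close> is 0 on infinite sets.\<close>

definition kth_largest :: "nat \<Rightarrow> real set \<Rightarrow> real" where
  "kth_largest k S = (THE r. r \<in> S \<and> card {s \<in> S. r \<le> s} = k)"

definition rho :: "nat \<Rightarrow> (nat, 'b) pre_digraph \<Rightarrow> real" where
  "rho k G = kth_largest k (distance_pareto_eigenvalues G)"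

lemma kth_largest_eqI:
  assumes "r \<in> S" "card {s \<in> S. r \<le> s} = k" "k \<ge> 1"
  shows "kth_largest k S = r"
  unfolding kth_largest_def
proof (rule the_equality)
  fix t assume t: "t \<in> S \<and> card {s \<in> S. t \<le> s} = k"
  have fin: "finite {s \<in> S. r \<le> s}" "finite {s \<in> S. t \<le> s}"
    using assms t by (auto intro: card_ge_0_finite)
  show "t = r"
  proof (rule ccontr)
    assume "t \<noteq> r"
    then consider "t < r" | "r < t" by linarith
    then show False
    proof cases
      case 1
      then have "{s \<in> S. r \<le> s} \<subseteq> {s \<in> S. t \<le> s} - {t}" by auto
      then have "{s \<in> S. r \<le> s} \<subset> {s \<in> S. t \<le> s}" using t by blast
      from psubset_card_mono[OF fin(2) this] show False using assms t by simp
    next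
      case 2
      then have "{s \<in> S. t \<le> s} \<subseteq> {s \<in> S. r \<le> s} - {r}" by auto
      then have "{s \<in> S. t \<le> s} \<subset> {s \<in> S. r \<le> s}" using assms by blast
      from psubset_card_mono[OF fin(1) this] show False using assms t by simp
    qed
  qed
qed (use assms in auto)

lemma pair_wf_cycle_graph: "pair_wf_digraph (cycle_graph n)"
  by unfold_locales (auto simp: cycle_graph_def)

lemma graph_cycle_graph:
  assumes "n \<ge> 3"
  shows "graph (cycle_graph n)"
proof -
  have "parcs (cycle_graph n) \<subseteq> {0..<n} \<times> {0..<n}"
    by (auto simp: cycle_graph_def)
  then have fin: "finite (parcs (cycle_graph n))"
    by (rule finite_subset) simp
  have neq: "i \<noteq> Suc i mod n" if "i < n" for i
    using assms that by (cases "Suc i = n") auto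
  interpret pair_graph "cycle_graph n"
  proof
    show "finite (parcs (cycle_graph n))" by (fact fin)
    show "symmetric (cycle_graph n)"
      by (auto simp: symmetric_def sym_def cycle_graph_def)
    show "fst e \<noteq> snd e" if "e \<in> parcs (cycle_graph n)" for e
      using that neq[of "fst e"] by (cases e) (auto simp: cycle_graph_def)
  qed (auto simp: cycle_graph_def)
  show ?thesis by (rule pair_graphD_graph)
qed

lemma graph_dist_refl:
  assumes "wf_digraph G" "u \<in> verts G"
  shows "graph_dist G u u = 0"
proof -
  interpret wf_digraph G by fact
  have "\<mu> (\<lambda>_. 1) u u \<le> 0"
    using min_cost_le_walk_cost[of u "[]" u "\<lambda>_. 1"] assms(2) by (simp add: awalk_Nil_iff zero_ereal_def)
  moreover have "\<mu> (\<lambda>_. 1) u u \<ge> 0"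
    unfolding \<mu>_def by (rule INF_greatest) (auto intro: pos_cost_pos_awalk_cost)
  ultimately show ?thesis by (simp add: graph_dist_def)
qed

lemma graph_dist_adj:
  assumes "wf_digraph G" "u \<rightarrow>\<^bsub>G\<^esub> v" "u \<noteq> v"
  shows "graph_dist G u v = 1"
proof -
  interpret wf_digraph G by fact
  obtain e where "arc e (u, v)" using assms(2) by (auto simp: arcs_ends_conv arc_def)
  then have "awalk u [e] v" by (auto simp: arc_def intro: arc_implies_awalk)
  from min_cost_le_walk_cost[OF this, of "\<lambda>_. 1"] have "\<mu> (\<lambda>_. 1) u v \<le> 1"
    by (simp add: one_ereal_def)
  moreover have "\<mu> (\<lambda>_. 1) u v \<ge> 1"
    unfolding \<mu>_def
  proof (rule INF_greatest)
    fix p assume "p \<in> {p. awalk u p v}"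
    then show "1 \<le> ereal (awalk_cost (\<lambda>_. 1) p)"
      using assms(3) by (cases p) (auto simp: awalk_Nil_iff awalk_cost_def sum_list_triv)
  qed
  ultimately have "\<mu> (\<lambda>_. 1) u v = 1" by simp
  then show ?thesis by (simp add: graph_dist_def)
qed

lemma distance_matrix_cycle_3:
  "distance_matrix (cycle_graph 3) = mat 3 3 (\<lambda>(i, j). if i = j then 0 else 1)"
proof -
  have wf: "wf_digraph (cycle_graph 3)"
    using pair_wf_cycle_graph[of 3] by (simp add: wf_digraph_wp_iff)
  have "graph_dist (cycle_graph 3) i j = (if i = j then 0 else 1)" if "i < 3" "j < 3" for i j
  proof (cases "i = j")
    case True
    then show ?thesis using graph_dist_refl[OF wf] that by (simp add: cycle_graph_def)
  next
    case False
    have "i \<in> {0, 1, 2}" "j \<in> {0, 1, 2}" using that by auto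
    then have "i \<rightarrow>\<^bsub>cycle_graph 3\<^esub> j" using False by (auto simp: cycle_graph_def)
    then show ?thesis using graph_dist_adj[OF wf] False by simp
  qed
  then show ?thesis
    unfolding distance_matrix_def by (intro eq_matI) (auto simp: cycle_graph_def)
qed

lemma pareto_eigenvalue_cycle_3_iff:
  "pareto_eigenvalue (distance_matrix (cycle_graph 3)) l \<longleftrightarrow>
   (\<exists>a b c. (a \<noteq> 0 \<or> b \<noteq> 0 \<or> c \<noteq> 0) \<and> a \<ge> 0 \<and> b \<ge> 0 \<and> c \<ge> 0 \<and>
      l * a \<le> b + c \<and> l * b \<le> a + c \<and> l * c \<le> a + b \<and>
      l = (a * (b + c) + b * (a + c) + c * (a + b)) / (a * a + b * b + c * c))"
  (is "?L \<longleftrightarrow> ?R")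
proof -
  let ?A = "mat 3 3 (\<lambda>(i, j). if i = j then 0 else 1) :: real mat"
  have all3: "(\<forall>i<3. P i) \<longleftrightarrow> P 0 \<and> P 1 \<and> P (2::nat)" for P
    by (auto simp: numeral_3_eq_3 less_Suc_eq numeral_2_eq_2)
  have sum3: "(\<Sum>i\<in>{0..<3}. f i) = f 0 + f 1 + f 2" for f :: "nat \<Rightarrow> real"
    by (simp add: numeral_3_eq_3 numeral_2_eq_2)
  have ent: "?A *\<^sub>v x = vec 3 (\<lambda>i. (\<Sum>j\<in>{0..<3}. (if i = j then 0 else x $ j)))"
    if "x \<in> carrier_vec 3" for x
    using that by (intro eq_vecI) (auto simp: scalar_prod_def intro!: sum.cong)
  have eq: "(x \<noteq> 0\<^sub>v 3 \<and> 0\<^sub>v 3 \<le> x \<and> l \<cdot>\<^sub>v x \<le> ?A *\<^sub>v x \<and>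
       l = (x \<bullet> (?A *\<^sub>v x)) / (x \<bullet> x)) \<longleftrightarrow>
     (a \<noteq> 0 \<or> b \<noteq> 0 \<or> c \<noteq> 0) \<and> a \<ge> 0 \<and> b \<ge> 0 \<and> c \<ge> 0 \<and>
      l * a \<le> b + c \<and> l * b \<le> a + c \<and> l * c \<le> a + b \<and>
      l = (a * (b + c) + b * (a + c) + c * (a + b)) / (a * a + b * b + c * c)"
    if x: "x \<in> carrier_vec 3" and abc: "a = x $ 0" "b = x $ 1" "c = x $ 2" for x a b c
  proof -
    have d: "dim_vec x = 3" using x by simp
    have "x = 0\<^sub>v 3 \<longleftrightarrow> (\<forall>i<3. x $ i = 0)" using d by (auto intro!: eq_vecI)
    then show ?thesis
      unfolding ent[OF x] less_eq_vec_def scalar_prod_def abc using d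
      by (simp add: all3 sum3)
  qed
  have "?L \<longleftrightarrow> (\<exists>x \<in> carrier_vec 3. x \<noteq> 0\<^sub>v 3 \<and> 0\<^sub>v 3 \<le> x \<and> l \<cdot>\<^sub>v x \<le> ?A *\<^sub>v x \<and>
       l = (x \<bullet> (?A *\<^sub>v x)) / (x \<bullet> x))"
    unfolding distance_matrix_cycle_3 pareto_eigenvalue_def by simp
  also have "\<dots> \<longleftrightarrow> ?R"
  proof
    assume "\<exists>x \<in> carrier_vec 3. x \<noteq> 0\<^sub>v 3 \<and> 0\<^sub>v 3 \<le> x \<and> l \<cdot>\<^sub>v x \<le> ?A *\<^sub>v x \<and>
       l = (x \<bullet> (?A *\<^sub>v x)) / (x \<bullet> x)"
    then obtain x where "x \<in> carrier_vec 3" and "x \<noteq> 0\<^sub>v 3 \<and> 0\<^sub>v 3 \<le> x \<and>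
       l \<cdot>\<^sub>v x \<le> ?A *\<^sub>v x \<and> l = (x \<bullet> (?A *\<^sub>v x)) / (x \<bullet> x)" by blast
    with eq[OF this(1) refl refl refl] show ?R by blast
  next
    assume ?R
    then obtain a b c where *: "(a \<noteq> 0 \<or> b \<noteq> 0 \<or> c \<noteq> 0) \<and> a \<ge> 0 \<and> b \<ge> 0 \<and> c \<ge> 0 \<and>
      l * a \<le> b + c \<and> l * b \<le> a + c \<and> l * c \<le> a + b \<and>
      l = (a * (b + c) + b * (a + c) + c * (a + b)) / (a * a + b * b + c * c)" by blast
    let ?x = "vec 3 (\<lambda>i. if i = 0 then a else if i = 1 then b else c)"
    have "?x \<in> carrier_vec 3" "a = ?x $ 0" "b = ?x $ 1" "c = ?x $ 2" by auto
    from eq[OF this] * \<open>?x \<in> carrier_vec 3\<close>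
    show "\<exists>x \<in> carrier_vec 3. x \<noteq> 0\<^sub>v 3 \<and> 0\<^sub>v 3 \<le> x \<and> l \<cdot>\<^sub>v x \<le> ?A *\<^sub>v x \<and>
       l = (x \<bullet> (?A *\<^sub>v x)) / (x \<bullet> x)" by blast
  qed
  finally show ?thesis .
qed

lemma distance_pareto_eigenvalues_cycle_3:
  "distance_pareto_eigenvalues (cycle_graph 3) = {0, 1, 2}"
proof (intro equalityI subsetI)
  fix l assume "l \<in> distance_pareto_eigenvalues (cycle_graph 3)"
  then obtain a b c where nz: "a \<noteq> 0 \<or> b \<noteq> 0 \<or> c \<noteq> 0" and ge: "a \<ge> 0" "b \<ge> 0" "c \<ge> 0"
    and le: "l * a \<le> b + c" "l * b \<le> a + c" "l * c \<le> a + b"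
    and l: "l = (a * (b + c) + b * (a + c) + c * (a + b)) / (a * a + b * b + c * c)"
    unfolding distance_pareto_eigenvalues_def pareto_eigenvalue_cycle_3_iff mem_Collect_eq by blast
  have "a * a + b * b + c * c \<noteq> 0" using nz
    by (metis add_nonneg_eq_0_iff mult_eq_0_iff sum_squares_ge_zero zero_le_square)
  with l have "l * (a * a + b * b + c * c) = a * (b + c) + b * (a + c) + c * (a + b)"
    by simp
  then have s: "a * (b + c - l * a) + b * (a + c - l * b) + c * (a + b - l * c) = 0"
    by (simp add: algebra_simps)
  have "a * (b + c - l * a) \<ge> 0" "b * (a + c - l * b) \<ge> 0" "c * (a + b - l * c) \<ge> 0"
    using ge le by auto
  with s have "a * (b + c - l * a) = 0" "b * (a + c - l * b) = 0" "c * (a + b - l * c) = 0"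
    by linarith+
  then have e: "a = 0 \<or> b + c = l * a" "b = 0 \<or> a + c = l * b" "c = 0 \<or> a + b = l * c"
    by auto
  have l0: "l \<ge> 0" unfolding l using ge by auto
  have cancel: "x = y" if "y + z = l * x" "x + z = l * y" for x z y :: real
  proof -
    have "(l + 1) * (x - y) = 0" using that by (simp add: algebra_simps)
    then show ?thesis using l0 by auto
  qed
  have two: "l = 1" if "y = l * x" "x = l * y" "x \<noteq> 0" for x y :: real
  proof -
    have "x = y" by (rule cancel[of _ 0]) (use that(1,2) in linarith)+
    with that(1) have "x = l * x" by metis
    then show ?thesis using that(3) by simp
  qed
  show "l \<in> {0, 1, 2}"
  proof (cases "a = 0"; cases "b = 0"; cases "c = 0")
    assume "a \<noteq> 0" "b \<noteq> 0" "c \<noteq> 0"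
    with e have e': "b + c = l * a" "a + c = l * b" "a + b = l * c" by auto
    have "a = b" by (rule cancel) (fact e'(1), fact e'(2))
    moreover have "a = c" by (rule cancel[of _ b]) (use e' in linarith)+
    ultimately have "2 * a = l * a" using e'(1) by linarith
    then show ?thesis using \<open>a \<noteq> 0\<close> by simp
  next
    assume "a = 0" "b \<noteq> 0" "c \<noteq> 0"
    then show ?thesis using two[of c b] e(2,3) by auto
  next
    assume "a \<noteq> 0" "b = 0" "c \<noteq> 0"
    then show ?thesis using two[of c a] e(1,3) by auto
  next
    assume "a \<noteq> 0" "b \<noteq> 0" "c = 0"
    then show ?thesis using two[of b a] e(1,2) by auto
  qed (use nz e in simp_all)
next
  fix l :: real assume "l \<in> {0, 1, 2}"
  then consider "l = 0" | "l = 1" | "l = 2" by auto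
  then have "\<exists>a b c :: real. (a \<noteq> 0 \<or> b \<noteq> 0 \<or> c \<noteq> 0) \<and> a \<ge> 0 \<and> b \<ge> 0 \<and> c \<ge> 0 \<and>
      l * a \<le> b + c \<and> l * b \<le> a + c \<and> l * c \<le> a + b \<and>
      l = (a * (b + c) + b * (a + c) + c * (a + b)) / (a * a + b * b + c * c)"
  proof cases
    case 1 then show ?thesis by (rule_tac x = 1 in exI, rule_tac x = 0 in exI, rule_tac x = 0 in exI) simp
  next
    case 2 then show ?thesis by (rule_tac x = 1 in exI, rule_tac x = 1 in exI, rule_tac x = 0 in exI) simp
  next
    case 3 then show ?thesis by (rule_tac x = 1 in exI, rule_tac x = 1 in exI, rule_tac x = 1 in exI) simp
  qed
  then show "l \<in> distance_pareto_eigenvalues (cycle_graph 3)"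
    by (simp add: distance_pareto_eigenvalues_def pareto_eigenvalue_cycle_3_iff)
qed

text \<open>For the triangle the two sides coincide, so the strict inequality fails there.\<close>

lemma rho_gap_cycle_3:
  "rho 1 (cycle_graph 3) - rho 2 (cycle_graph 3)
     = 1 / (real 3 - 1) * of_int \<lfloor>(real 3)\<^sup>2 / 4\<rfloor>"
proof -
  have "{s \<in> {0, 1, 2 :: real}. 2 \<le> s} = {2}" "{s \<in> {0, 1, 2 :: real}. 1 \<le> s} = {1, 2}" by auto
  then have "rho 1 (cycle_graph 3) = 2" "rho 2 (cycle_graph 3) = 1"
    unfolding rho_def distance_pareto_eigenvalues_cycle_3 by (auto intro!: kth_largest_eqI)
  moreover have "\<lfloor>9 / 4 :: real\<rfloor> = 2" by (simp add: floor_eq_iff)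
  ultimately show ?thesis by simp
qed

end

(* Write W for the common row sum n^2 div 4 of the distance matrix D. A Pareto eigenvector with
   positive entries is an ordinary eigenvector, and summing its entries gives the eigenvalue W.
   Every other Pareto eigenvector has a zero entry, so its eigenvalue is at most the maximum r of
   the Rayleigh quotient over the boundary of the nonnegative orthant. First-order conditions show
   that r itself is a Pareto eigenvalue, and r < W, so r is the second largest one. The boundary
   vector 1 - e_0 has Rayleigh quotient W (n - 2) / (n - 1) = W - W / (n - 1). This is strictly
   less than r: a maximizer is an eigenvector on its support, which would force D_10 = D_20. *)

theory Submission
  imports Defs "HOL-Analysis.Function_Topology"
begin

section \<open>Pareto eigenvalues of symmetric matrices with constant row sum\<close>

locale transmission_regular =
  fixes n :: nat and d :: "nat \<Rightarrow> nat \<Rightarrow> real" and W :: real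
  assumes d_sym: "i < n \<Longrightarrow> j < n \<Longrightarrow> d i j = d j i"
    and d_diag: "i < n \<Longrightarrow> d i i = 0"
    and d_pos: "i < n \<Longrightarrow> j < n \<Longrightarrow> i \<noteq> j \<Longrightarrow> 0 < d i j"
    and row_sum: "i < n \<Longrightarrow> (\<Sum>j<n. d i j) = W"
begin

text \<open>Vectors are encoded as functions on \<open>nat\<close> of which only the values below
  \<open>n\<close> matter. This makes function update and the product topology available;
  \<open>pareto_eigenvalue_iff\<close> links back to matrices.\<close>

definition app :: "(nat \<Rightarrow> real) \<Rightarrow> nat \<Rightarrow> real" where
  "app x i = (\<Sum>j<n. d i j * x j)"

definition quad :: "(nat \<Rightarrow> real) \<Rightarrow> real" where
  "quad x = (\<Sum>i<n. x i * app x i)"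

definition sq :: "(nat \<Rightarrow> real) \<Rightarrow> real" where
  "sq x = (\<Sum>i<n. x i * x i)"

definition pareto :: "real \<Rightarrow> bool" where
  "pareto l \<longleftrightarrow> (\<exists>x. (\<forall>i<n. 0 \<le> x i) \<and> (\<exists>i<n. x i \<noteq> 0) \<and>
     (\<forall>i<n. l * x i \<le> app x i) \<and> l * sq x = quad x)"

text \<open>For positive \<open>n\<close> the zero vector belongs to this set. Bounds on the
  Rayleigh quotient are therefore stated without division, as \<open>quad y \<le> r * sq y\<close>,
  which is trivial at zero.\<close>

definition boundary :: "(nat \<Rightarrow> real) set" where
  "boundary = {x. (\<forall>i<n. 0 \<le> x i) \<and> (\<exists>i<n. x i = 0)}"

lemma sq_pos: "i < n \<Longrightarrow> x i \<noteq> 0 \<Longrightarrow> 0 < sq x"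
  unfolding sq_def by (rule sum_pos2[of _ i]) (auto simp flip: power2_eq_square)

lemma pareto_eigenvalue_iff: "pareto_eigenvalue (mat n n (\<lambda>(i, j). d i j)) l \<longleftrightarrow> pareto l"
proof -
  let ?A = "mat n n (\<lambda>(i, j). d i j)"
  have app_vec: "?A *\<^sub>v vec n x = vec n (app x)" for x
    by (intro eq_vecI) (auto simp: scalar_prod_def app_def atLeast0LessThan)
  have vec_eq: "vec n x = 0\<^sub>v n \<longleftrightarrow> \<not> (\<exists>i<n. x i \<noteq> 0)" for x :: "nat \<Rightarrow> real"
    by (auto simp: vec_eq_iff)
  let ?P = "\<lambda>v. v \<noteq> 0\<^sub>v n \<and> 0\<^sub>v n \<le> v \<and> l \<cdot>\<^sub>v v \<le> ?A *\<^sub>v v \<and> l = (v \<bullet> (?A *\<^sub>v v)) / (v \<bullet> v)"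
  have "?P (vec n x) \<longleftrightarrow> (\<forall>i<n. 0 \<le> x i) \<and> (\<exists>i<n. x i \<noteq> 0) \<and>
      (\<forall>i<n. l * x i \<le> app x i) \<and> l * sq x = quad x" for x
  proof -
    have "vec n x \<bullet> vec n (app x) = quad x" "vec n x \<bullet> vec n x = sq x"
      by (simp_all add: scalar_prod_def atLeast0LessThan quad_def sq_def)
    then have "?P (vec n x) \<longleftrightarrow> (\<forall>i<n. 0 \<le> x i) \<and> (\<exists>i<n. x i \<noteq> 0) \<and>
        (\<forall>i<n. l * x i \<le> app x i) \<and> l = quad x / sq x"
      unfolding app_vec vec_eq by (auto simp: less_eq_vec_def)
    moreover have "l = quad x / sq x \<longleftrightarrow> l * sq x = quad x" if "\<exists>i<n. x i \<noteq> 0"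
    proof -
      have "sq x \<noteq> 0" using that sq_pos by fastforce
      then show ?thesis by (simp add: eq_divide_eq)
    qed
    ultimately show ?thesis by blast
  qed
  then have "(\<exists>x. ?P (vec n x)) \<longleftrightarrow> pareto l"
    unfolding pareto_def by (intro ex_cong1) blast
  moreover have "(\<exists>v\<in>carrier_vec n. ?P v) \<longleftrightarrow> (\<exists>x. ?P (vec n x))"
  proof
    assume "\<exists>v\<in>carrier_vec n. ?P v"
    then obtain v where v: "v \<in> carrier_vec n" "?P v" by blast
    have "v = vec n (($) v)" using v(1) by (intro eq_vecI) auto
    with v(2) show "\<exists>x. ?P (vec n x)" by metis
  qed (use vec_carrier in blast)
  ultimately show ?thesis
    unfolding pareto_eigenvalue_def by simp
qed

text \<open>By symmetry the column sums equal \<open>W\<close> too. Summing entries thus compares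
  any eigenvalue with \<open>W\<close>.\<close>

lemma sum_app: "(\<Sum>i<n. app x i) = W * (\<Sum>i<n. x i)"
proof -
  have "(\<Sum>i<n. app x i) = (\<Sum>j<n. \<Sum>i<n. d i j * x j)"
    unfolding app_def by (rule sum.swap)
  also have "\<dots> = (\<Sum>j<n. (\<Sum>i<n. d j i) * x j)"
    by (auto simp: sum_distrib_right d_sym intro!: sum.cong)
  also have "\<dots> = W * (\<Sum>j<n. x j)"
    by (simp add: row_sum sum_distrib_left)
  finally show ?thesis .
qed

section \<open>Maximizing the Rayleigh quotient over the boundary\<close>

lemma app_upd:
  assumes "i < n"
  shows "app (x(i := x i + t)) k = app x k + t * d k i"
proof -
  have "app (x(i := x i + t)) k = (\<Sum>j<n. d k j * x j + (if j = i then t * d k i else 0))"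
    unfolding app_def by (intro sum.cong) (auto simp: algebra_simps)
  also have "\<dots> = app x k + t * d k i"
    using assms by (simp add: sum.distrib app_def)
  finally show ?thesis .
qed

text \<open>The zero diagonal removes the quadratic term in \<open>t\<close>, and symmetry merges
  the row and column contributions.\<close>

lemma quad_upd:
  assumes "i < n"
  shows "quad (x(i := x i + t)) = quad x + 2 * t * app x i"
proof -
  have "quad (x(i := x i + t)) =
      (\<Sum>k<n. x k * app x k + t * (d k i * x k) + (if k = i then t * (app x i + t * d i i) else 0))"
    unfolding quad_def app_upd[OF assms]
    by (intro sum.cong) (auto simp: algebra_simps)
  also have "\<dots> = quad x + t * (\<Sum>k<n. d k i * x k) + t * app x i"
    using assms by (simp add: sum.distrib quad_def sum_distrib_left[symmetric] d_diag)
  also have "(\<Sum>k<n. d k i * x k) = app x i"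
    unfolding app_def using d_sym[OF _ assms] by (intro sum.cong) auto
  also have "quad x + t * app x i + t * app x i = quad x + 2 * t * app x i"
    by simp
  finally show ?thesis .
qed

lemma sq_upd:
  assumes "i < n"
  shows "sq (x(i := x i + t)) = sq x + 2 * t * x i + t\<^sup>2"
proof -
  have "sq (x(i := x i + t)) = (\<Sum>k<n. x k * x k + (if k = i then 2 * t * x i + t\<^sup>2 else 0))"
    unfolding sq_def by (intro sum.cong) (auto simp: algebra_simps power2_eq_square)
  also have "\<dots> = sq x + 2 * t * x i + t\<^sup>2"
    using assms by (simp add: sum.distrib sq_def)
  finally show ?thesis .
qed

text \<open>A small change of a positive coordinate, in either direction, keeps the vector
  nonnegative and leaves its zero entry elsewhere untouched. Hence \<open>t = 0\<close> is an
  interior local maximum of \<open>quad - r * sq\<close> along that coordinate, and the derivative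
  vanishes.\<close>

lemma boundary_maximizer_critical:
  assumes max: "\<And>y. y \<in> boundary \<Longrightarrow> quad y \<le> r * sq y"
    and x: "x \<in> boundary" "quad x = r * sq x" and i: "i < n" "0 < x i"
  shows "app x i = r * x i"
proof -
  let ?a = "app x i - r * x i"
  let ?g = "\<lambda>t. 2 * t * ?a - r * t\<^sup>2"
  have "?g t \<le> ?g 0" if "\<bar>0 - t\<bar> < x i" for t
  proof -
    have "x(i := x i + t) \<in> boundary"
      using x(1) i that unfolding boundary_def by fastforce
    from max[OF this] x(2) show ?thesis
      unfolding quad_upd[OF i(1)] sq_upd[OF i(1)] by (simp add: algebra_simps)
  qed
  moreover have "DERIV ?g 0 :> 2 * ?a"
    by (auto intro!: derivative_eq_intros)
  ultimately have "2 * ?a = 0"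
    using i(2) by (intro DERIV_local_max) auto
  then show ?thesis by simp
qed

lemma app_nonneg: "i < n \<Longrightarrow> (\<And>j. j < n \<Longrightarrow> 0 \<le> x j) \<Longrightarrow> 0 \<le> app x i"
  unfolding app_def by (intro sum_nonneg) (metis d_diag d_pos lessThan_iff less_eq_real_def mult_nonneg_nonneg)

lemma boundary_maximum_exists:
  assumes "2 \<le> n"
  obtains r x where "\<And>y. y \<in> boundary \<Longrightarrow> quad y \<le> r * sq y"
    and "x \<in> boundary" "0 < sq x" "quad x = r * sq x"
proof -
  \<comment> \<open>Pinning the coordinates from \<open>n\<close> on to 0 makes the box compact by
    Tychonoff's theorem. The bound 1 loses nothing, since entries of a nonnegative unit vector are
    at most 1.\<close>
  let ?C = "PiE UNIV (\<lambda>i. if i < n then {0..1} else {0 :: real})"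
  let ?Z = "\<Union>i<n. {x :: nat \<Rightarrow> real. x i = 0}"
  let ?K = "?C \<inter> ({x. sq x = 1} \<inter> ?Z)"
  have cont: "continuous_on UNIV sq" "continuous_on UNIV quad"
    unfolding sq_def[abs_def] quad_def[abs_def] app_def[abs_def]
    by (intro continuous_intros continuous_on_product_coordinates)+
  have "compactin (product_topology (\<lambda>_. euclidean) UNIV) ?C"
    unfolding compactin_PiE by (auto simp: compactin_euclidean_iff)
  then have "compact ?C"
    by (simp add: euclidean_product_topology compactin_euclidean_iff)
  moreover have "closed {x. sq x = 1}"
    by (intro closed_Collect_eq cont continuous_intros)
  moreover have "closed ?Z"
    by (intro closed_UN ballI closed_Collect_eq continuous_intros) auto
  ultimately have "compact ?K"
    by (intro compact_Int_closed closed_Int)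
  moreover have "?K \<noteq> {}"
  proof
    assume "?K = {}"
    \<comment> \<open>The first unit vector has a zero entry at index 1, which is below
      \<open>n\<close> because \<open>2 \<le> n\<close>.\<close>
    moreover have "(\<lambda>i. if i = 0 then 1 else 0) \<in> ?K"
      using assms by (auto simp: sq_def if_distrib cong: if_cong intro!: bexI[of _ 1])
    ultimately show False by (metis empty_iff)
  qed
  moreover have "continuous_on ?K quad"
    by (rule continuous_on_subset[OF cont(2)]) simp
  ultimately have "\<exists>x\<in>?K. \<forall>y\<in>?K. quad y \<le> quad x"
    by (rule continuous_attains_sup)
  then obtain x where x: "x \<in> ?K" and max: "\<And>y. y \<in> ?K \<Longrightarrow> quad y \<le> quad x"
    by (elim bexE) (erule that, erule bspec)
  show thesis
  proof
    \<comment> \<open>Since \<open>sq x = 1\<close>, the maximum \<open>quad x\<close> serves as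
      \<open>r\<close>. A nonzero \<open>y\<close> is scaled to norm 1 and cut off at
      \<open>n\<close> in order to land in \<open>?K\<close>.\<close>
    show "quad y \<le> quad x * sq y" if y: "y \<in> boundary" for y
    proof (cases "\<exists>i<n. y i \<noteq> 0")
      case False
      then show ?thesis by (simp add: quad_def sq_def)
    next
      case True
      then have pos: "0 < sq y" using sq_pos by blast
      define s where "s = sqrt (sq y)"
      have s: "0 < s" "s * s = sq y" using pos by (auto simp: s_def)
      define z where "z = (\<lambda>i. if i < n then y i / s else 0)"
      have "app z i = app y i / s" for i
        by (simp add: app_def z_def sum_divide_distrib)
      then have "quad z = (\<Sum>i<n. y i * app y i / (s * s))"
        unfolding quad_def by (intro sum.cong) (auto simp: z_def)
      then have q: "quad z = quad y / sq y"
        by (simp add: s(2) quad_def sum_divide_distrib)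
      have "sq z = (\<Sum>i<n. y i * y i / (s * s))"
        unfolding sq_def by (intro sum.cong) (auto simp: z_def)
      also have "\<dots> = sq y / sq y"
        unfolding s(2) sum_divide_distrib[symmetric] sq_def[symmetric] ..
      finally have "sq z = 1" using pos by simp
      moreover have "y i \<le> s" if "i < n" for i
      proof -
        have "y i * y i \<le> sq y"
          unfolding sq_def using that by (intro member_le_sum) auto
        then show ?thesis unfolding s_def
          by (simp add: real_le_rsqrt power2_eq_square)
      qed
      ultimately have "z \<in> ?K"
        using y s(1) by (fastforce simp: z_def boundary_def)
      from max[OF this] show ?thesis
        using pos by (simp add: q field_simps)
    qed
    show "x \<in> boundary" using x by (auto simp: boundary_def PiE_iff split: if_splits)
    show "0 < sq x" "quad x = quad x * sq x" using x by auto
  qed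
qed

section \<open>The two largest Pareto eigenvalues\<close>

lemma pareto_row_sum:
  assumes "0 < n"
  shows "pareto W"
proof -
  have "app (\<lambda>_. 1) i = W" if "i < n" for i
    using that by (simp add: app_def row_sum)
  then show ?thesis
    unfolding pareto_def quad_def sq_def using assms by (intro exI[of _ "\<lambda>_. 1"]) auto
qed

text \<open>The quotient condition makes a sum of nonnegative terms vanish, so every inequality is
  an equality where \<open>x\<close> is positive, that is, everywhere. Summing these equalities and
  cancelling the positive entry sum leaves \<open>l = W\<close>.\<close>

lemma pareto_interior:
  assumes x: "\<And>i. i < n \<Longrightarrow> 0 < x i" "\<And>i. i < n \<Longrightarrow> l * x i \<le> app x i" "l * sq x = quad x"
    and n: "0 < n"
  shows "l = W"
proof -
  have "(\<Sum>i<n. x i * (app x i - l * x i)) = quad x - l * sq x"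
    by (simp add: quad_def sq_def sum_subtractf right_diff_distrib sum_distrib_left mult_ac)
  also have "\<dots> = 0" using x by simp
  finally have zero: "\<forall>i\<in>{..<n}. x i * (app x i - l * x i) = 0"
    using x by (subst (asm) sum_nonneg_eq_0_iff) (auto simp: less_imp_le)
  have "app x i = l * x i" if "i < n" for i
  proof -
    have "x i * (app x i - l * x i) = 0" using zero that by blast
    then show ?thesis using x(1)[OF that] by simp
  qed
  then have "(\<Sum>i<n. app x i) = l * (\<Sum>i<n. x i)"
    by (simp add: sum_distrib_left)
  then have "W * (\<Sum>i<n. x i) = l * (\<Sum>i<n. x i)"
    by (simp only: sum_app)
  moreover have "0 < (\<Sum>i<n. x i)"
    using n x(1) by (intro sum_pos) auto
  ultimately show ?thesis by simp
qed

text \<open>The value \<open>r\<close> is the maximum of the Rayleigh quotient on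
  \<open>boundary\<close>. Two different off-diagonal entries in row \<open>i\<close> make the last
  bound strict; in the triangle they all agree and equality holds.\<close>

lemma second_pareto:
  assumes n: "2 \<le> n" and ijk: "i < n" "j < n" "k < n" "i \<noteq> j" "i \<noteq> k" "d i j \<noteq> d i k"
  obtains r where "pareto r" "r < W" "\<And>l. pareto l \<Longrightarrow> l \<noteq> W \<Longrightarrow> l \<le> r"
    "W - r < W / (real n - 1)"
proof -
  obtain r x where max: "\<And>y. y \<in> boundary \<Longrightarrow> quad y \<le> r * sq y"
    and x: "x \<in> boundary" "0 < sq x" "quad x = r * sq x"
    using boundary_maximum_exists[OF n] by blast
  have x0: "\<And>i. i < n \<Longrightarrow> 0 \<le> x i" using x(1) by (auto simp: boundary_def)
  \<comment> \<open>On the support this is an equality by criticality; elsewhere the left side is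
    0.\<close>
  have le: "r * x i \<le> app x i" if "i < n" for i
    using boundary_maximizer_critical[OF max x(1,3) that] x0[OF that] app_nonneg[OF that x0]
    by (cases "x i = 0") auto
  have "\<exists>m<n. x m \<noteq> 0"
  proof (rule ccontr)
    assume "\<not> (\<exists>m<n. x m \<noteq> 0)"
    then have "sq x = 0" by (simp add: sq_def)
    with x(2) show False by simp
  qed
  then obtain m where m: "m < n" "x m \<noteq> 0" by blast
  obtain z where z: "z < n" "x z = 0" using x(1) by (auto simp: boundary_def)
  show thesis
  proof
    show "pareto r"
      unfolding pareto_def using x0 le x m by (intro exI[of _ x]) auto
    \<comment> \<open>At the zero coordinate \<open>z\<close> the inequality is strict, because the
      positive entry \<open>x m\<close> contributes with the positive weight \<open>d z m\<close>.
      Summing over all coordinates then separates \<open>r\<close> from \<open>W\<close>.\<close>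
    have "0 < app x z"
      unfolding app_def
    proof (rule sum_pos2[of _ m])
      show "0 < d z m * x m" using m z x0[OF m(1)] d_pos[OF z(1) m(1)] by (cases "z = m") auto
      show "0 \<le> d z j * x j" if "j \<in> {..<n}" for j
        using that z x0[of j] d_pos[OF z(1), of j] by (cases "z = j") auto
    qed (use m in auto)
    then have "(\<Sum>i<n. r * x i) < (\<Sum>i<n. app x i)"
      using z le by (intro sum_strict_mono_ex1) (auto intro!: bexI[of _ z])
    then have "r * (\<Sum>i<n. x i) < W * (\<Sum>i<n. x i)"
      by (simp add: sum_app flip: sum_distrib_left)
    moreover have "0 \<le> (\<Sum>i<n. x i)" by (intro sum_nonneg) (simp add: x0)
    ultimately show "r < W" by (simp add: mult_less_cancel_right)
    show "l \<le> r" if l: "pareto l" "l \<noteq> W" for l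
    proof -
      obtain y where y: "\<forall>i<n. 0 \<le> y i" "\<exists>i<n. y i \<noteq> 0" "\<forall>i<n. l * y i \<le> app y i"
        "l * sq y = quad y"
        using l(1) unfolding pareto_def by blast
      have "y \<in> boundary"
        using pareto_interior[of y l] y l(2) n by (fastforce simp: boundary_def less_le)
      from max[OF this] have "l * sq y \<le> r * sq y" by (simp only: y(4))
      moreover have "0 < sq y" using y(2) sq_pos by blast
      ultimately show ?thesis by (rule mult_right_le_imp_le)
    qed
    \<comment> \<open>The test vector is the all-ones vector changed by -1 at \<open>i\<close>, so
      the update lemmas give its Rayleigh quotient \<open>W * (n - 2) / (n - 1)\<close>.\<close>
    let ?u = "(\<lambda>_. 1)(i := 0 :: real)"
    have ub: "?u \<in> boundary" using ijk by (auto simp: boundary_def)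
    have one: "app (\<lambda>_. 1) k = W" if "k < n" for k
      using that by (simp add: app_def row_sum)
    have "quad ?u = quad (\<lambda>_. 1) - 2 * W"
      using quad_upd[OF ijk(1), of "\<lambda>_. 1" "- 1"] one[OF ijk(1)] by simp
    also have "quad (\<lambda>_. 1) = W * real n"
      unfolding quad_def using one by simp
    also have "W * real n - 2 * W = W * (real n - 2)"
      by (simp add: algebra_simps)
    finally have qu: "quad ?u = W * (real n - 2)" .
    have "sq ?u = sq (\<lambda>_. 1) - 1"
      using sq_upd[OF ijk(1), of "\<lambda>_. 1" "- 1"] by simp
    also have "\<dots> = real n - 1"
      by (simp add: sq_def)
    finally have su: "sq ?u = real n - 1" .
    have au: "app ?u k = W - d i k" if "k < n" for k
      using app_upd[OF ijk(1), of "\<lambda>_. 1" "- 1" k] one[OF that] d_sym[OF that ijk(1)] by simp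
    \<comment> \<open>Equality would make \<open>?u\<close> a maximizer, hence critical. Then
      \<open>W - d i k = r\<close> for every index other than \<open>i\<close>, so row
      \<open>i\<close> would be constant off the diagonal.\<close>
    have "quad ?u \<noteq> r * sq ?u"
    proof
      assume "quad ?u = r * sq ?u"
      then have "app ?u k = r" if "k < n" "k \<noteq> i" for k
        using boundary_maximizer_critical[OF max ub _ that(1)] that(2) by simp
      from this[of j] this[of k] show False using au ijk by simp
    qed
    with max[OF ub] have "W * (real n - 2) < r * (real n - 1)"
      unfolding qu su by simp
    then show "W - r < W / (real n - 1)"
      using n by (simp add: field_simps)
  qed
qed

lemma kth_largest_pareto_gap:
  assumes n: "2 \<le> n" and ijk: "i < n" "j < n" "k < n" "i \<noteq> j" "i \<noteq> k" "d i j \<noteq> d i k"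
  shows "kth_largest 1 {l. pareto l} - kth_largest 2 {l. pareto l} < W / (real n - 1)"
proof -
  obtain r where r: "pareto r" "r < W" "\<And>l. pareto l \<Longrightarrow> l \<noteq> W \<Longrightarrow> l \<le> r"
    "W - r < W / (real n - 1)"
    using second_pareto[OF assms] by blast
  have W: "pareto W" using pareto_row_sum n by simp
  have "{s \<in> {l. pareto l}. W \<le> s} = {W}" "{s \<in> {l. pareto l}. r \<le> s} = {r, W}"
    using r W by force+
  then have "kth_largest 1 {l. pareto l} = W" "kth_largest 2 {l. pareto l} = r"
    using r(1,2) W by (auto intro!: kth_largest_eqI)
  then show ?thesis using r(4) by simp
qed

end

section \<open>Distances in the cycle\<close>

definition cycle_dist :: "nat \<Rightarrow> nat \<Rightarrow> nat \<Rightarrow> nat" where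
  "cycle_dist n i j = (let k = (if i \<le> j then j - i else i - j) in min k (n - k))"

text \<open>Replaces minimum and absolute difference by linear inequalities: the first disjunct is
  the route that avoids the edge between \<open>n - 1\<close> and 0, the other two are the routes
  through it.\<close>

lemma cycle_dist_le_iff:
  assumes "i < n" "j < n"
  shows "cycle_dist n i j \<le> k \<longleftrightarrow> i \<le> j + k \<and> j \<le> i + k \<or> n + i \<le> j + k \<or> n + j \<le> i + k"
  using assms unfolding cycle_dist_def Let_def min_le_iff_disj by (cases "i \<le> j") auto

lemma cycle_dist_step:
  assumes "u < n" "v < n" "w < n" "w = (v + 1) mod n \<or> v = (w + 1) mod n"
  shows "cycle_dist n v u \<le> Suc (cycle_dist n w u)"
proof -
  define k where "k = cycle_dist n w u"
  have "(a + 1) mod n = (if a + 1 = n then 0 else a + 1)" if "a < n" for a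
    using that by auto
  then have "w = v + 1 \<or> v = w + 1 \<or> w = 0 \<and> v + 1 = n \<or> v = 0 \<and> w + 1 = n"
    using assms by metis
  moreover have "w \<le> u + k \<and> u \<le> w + k \<or> n + w \<le> u + k \<or> n + u \<le> w + k"
    using assms by (simp add: k_def flip: cycle_dist_le_iff)
  ultimately have "v \<le> u + Suc k \<and> u \<le> v + Suc k \<or> n + v \<le> u + Suc k \<or> n + u \<le> v + Suc k"
    using assms(1-3) by (elim disjE conjE) linarith+
  then have "cycle_dist n v u \<le> Suc k"
    using cycle_dist_le_iff[OF assms(2,1)] by blast
  then show ?thesis by (simp only: k_def)
qed

text \<open>Each arc lowers the distance to \<open>v\<close> by at most one, by
  \<open>cycle_dist_step\<close>.\<close>

lemma cycle_walk_ge: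
  assumes "pre_digraph.awalk (cycle_graph n) u p v"
  shows "cycle_dist n u v \<le> length p"
proof -
  interpret pair_wf_digraph "cycle_graph n" by (rule pair_wf_cycle_graph)
  from assms show ?thesis
  proof (induction p arbitrary: u)
    case Nil
    then show ?case by (auto simp: awalk_Nil_iff cycle_dist_def)
  next
    case (Cons e p)
    then have e: "e \<in> parcs (cycle_graph n)" "u = fst e" and p: "awalk (snd e) p v"
      by (auto simp: awalk_Cons_iff)
    have "v < n" using awalk_last_in_verts[OF p] by (simp add: cycle_graph_def)
    with e have "cycle_dist n u v \<le> Suc (cycle_dist n (snd e) v)"
      by (intro cycle_dist_step) (auto simp: cycle_graph_def)
    with Cons.IH[OF p] show ?case by simp
  qed
qed

lemma cycle_walk_around:
  assumes "i < n"
  shows "\<exists>p. pre_digraph.awalk (cycle_graph n) i p ((i + k) mod n) \<and> length p = k"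
    and "\<exists>p. pre_digraph.awalk (cycle_graph n) ((i + k) mod n) p i \<and> length p = k"
proof -
  interpret pair_wf_digraph "cycle_graph n" by (rule pair_wf_cycle_graph)
  let ?v = "\<lambda>k. (i + k) mod n"
  have arcs: "(?v k, ?v (Suc k)) \<in> parcs (cycle_graph n)" "(?v (Suc k), ?v k) \<in> parcs (cycle_graph n)" for k
    using assms by (auto simp: cycle_graph_def mod_Suc_eq)
  show "\<exists>p. awalk i p (?v k) \<and> length p = k"
  proof (induction k)
    case 0
    have "awalk i [] i" using assms unfolding awalk_Nil_iff by (simp add: cycle_graph_def)
    then show ?case using assms by simp
  next
    case (Suc k)
    then obtain p where p: "awalk i p (?v k)" "length p = k" by blast
    have "awalk (?v k) [(?v k, ?v (Suc k))] (?v (Suc k))"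
      using arc_implies_awalk[of "(?v k, ?v (Suc k))"] arcs by simp
    from awalk_appendI[OF p(1) this] p(2) show ?case
      by (metis length_append_singleton)
  qed
  show "\<exists>p. awalk (?v k) p i \<and> length p = k"
  proof (induction k)
    case 0
    have "awalk i [] i" using assms unfolding awalk_Nil_iff by (simp add: cycle_graph_def)
    then show ?case using assms by simp
  next
    case (Suc k)
    then obtain p where p: "awalk (?v k) p i" "length p = k" by blast
    then have "awalk (?v (Suc k)) ((?v (Suc k), ?v k) # p) i"
      using arcs by (simp add: awalk_Cons_iff)
    with p(2) show ?case by (metis length_Cons)
  qed
qed

lemma cycle_walk_exists:
  assumes "i < n" "j < n"
  shows "\<exists>p. pre_digraph.awalk (cycle_graph n) i p j \<and> length p = cycle_dist n i j"
proof (cases "i \<le> j")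
  case True
  define k where "k = j - i"
  \<comment> \<open>There are two walks from \<open>i\<close> to \<open>j\<close>: forward with
    \<open>k\<close> arcs, or backward with \<open>n - k\<close> arcs. The backward one exists
    because going \<open>n - k\<close> forward from \<open>j\<close> wraps around to
    \<open>i\<close>.\<close>
  have "(i + k) mod n = j" "(j + (n - k)) mod n = i" "cycle_dist n i j = k \<or> cycle_dist n i j = n - k"
    using assms True by (auto simp: k_def cycle_dist_def min_def Let_def)
  then show ?thesis
    using cycle_walk_around(1)[OF assms(1), of k] cycle_walk_around(2)[OF assms(2), of "n - k"]
    by metis
next
  case False
  define k where "k = i - j"
  have "(j + k) mod n = i" "(i + (n - k)) mod n = j" "cycle_dist n i j = k \<or> cycle_dist n i j = n - k"
    using assms False by (auto simp: k_def cycle_dist_def min_def Let_def)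
  then show ?thesis
    using cycle_walk_around(2)[OF assms(2), of k] cycle_walk_around(1)[OF assms(1), of "n - k"]
    by metis
qed

lemma graph_dist_cycle:
  assumes "i < n" "j < n"
  shows "graph_dist (cycle_graph n) i j = real (cycle_dist n i j)"
proof -
  interpret pair_wf_digraph "cycle_graph n" by (rule pair_wf_cycle_graph)
  have cost: "awalk_cost (\<lambda>_. 1) p = real (length p)" for p
    by (simp add: awalk_cost_def sum_list_triv)
  obtain p where p: "awalk i p j" "length p = cycle_dist n i j"
    using cycle_walk_exists[OF assms] by blast
  have "\<mu> (\<lambda>_. 1) i j = ereal (real (cycle_dist n i j))"
  proof (rule antisym)
    show "\<mu> (\<lambda>_. 1) i j \<le> ereal (real (cycle_dist n i j))"
      using min_cost_le_walk_cost[OF p(1), of "\<lambda>_. 1"] p(2) by (simp add: cost)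
    show "ereal (real (cycle_dist n i j)) \<le> \<mu> (\<lambda>_. 1) i j"
      unfolding \<mu>_def by (rule INF_greatest) (auto simp: cost dest: cycle_walk_ge)
  qed
  then show ?thesis by (simp add: graph_dist_def)
qed

section \<open>Row sums of the cycle distance, and the conclusion\<close>

lemma sum_min_reflect: "(\<Sum>k<n. min k (n - k)) = n ^ 2 div 4" for n :: nat
proof (induction n rule: induct_nat_012)
  case (ge2 n)
  \<comment> \<open>Stepping by two fits the floor: dropping the zero term at \<open>k = 0\<close>
    and shifting the index leaves \<open>n + 1\<close> terms, each one larger than the corresponding
    term for \<open>n\<close>, where the term at \<open>k = n\<close> is 0. The increase
    \<open>n + 1\<close> is exactly a quarter of \<open>(n + 2)^2 - n^2\<close>.\<close>
  have "(\<Sum>k<Suc (Suc n). min k (Suc (Suc n) - k)) = (\<Sum>k<Suc n. min (Suc k) (Suc n - k))"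
    by (subst sum.lessThan_Suc_shift) simp
  also have "\<dots> = (\<Sum>k<Suc n. Suc (min k (n - k)))"
    by (intro sum.cong) auto
  also have "\<dots> = (\<Sum>k<n. min k (n - k)) + Suc n"
    by (simp add: sum.distrib sum_Suc)
  also have "\<dots> = (n\<^sup>2 + 4 * Suc n) div 4"
    using ge2 by simp
  also have "n\<^sup>2 + 4 * Suc n = (Suc (Suc n))\<^sup>2"
    by (simp add: power2_eq_square)
  finally show ?case .
qed auto

lemma sum_cycle_dist:
  assumes "i < n"
  shows "(\<Sum>j<n. cycle_dist n i j) = n\<^sup>2 div 4"
proof -
  let ?c = "\<lambda>k. min k (n - k)"
  \<comment> \<open>This is \<open>j - i\<close> modulo \<open>n\<close>, a rotation moving
    \<open>i\<close> to 0; its inverse is the rotation by \<open>i\<close>.\<close>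
  let ?f = "\<lambda>j. if i \<le> j then j - i else j + n - i"
  have "bij_betw ?f {..<n} {..<n}"
    using assms
    by (intro bij_betw_byWitness[where f' = "\<lambda>k. if k + i < n then k + i else k + i - n"])
      (auto split: if_splits)
  then have "(\<Sum>k<n. ?c k) = (\<Sum>j<n. ?c (?f j))"
    by (rule sum.reindex_bij_betw[symmetric])
  also have "\<dots> = (\<Sum>j<n. cycle_dist n i j)"
    using assms by (intro sum.cong) (auto simp: cycle_dist_def)
  finally show ?thesis by (simp add: sum_min_reflect)
qed

theorem theorem3p1:
  fixes n :: nat
  assumes "n \<ge> 4"
  shows "rho 1 (cycle_graph n) - rho 2 (cycle_graph n)
           < 1 / (real n - 1) * of_int \<lfloor>(real n)\<^sup>2 / 4\<rfloor>"
proof -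
  let ?d = "\<lambda>i j. real (cycle_dist n i j)"
  interpret transmission_regular n ?d "real (n\<^sup>2 div 4)"
  proof
    show "(\<Sum>j<n. ?d i j) = real (n\<^sup>2 div 4)" if "i < n" for i
      using sum_cycle_dist[OF that] by (metis of_nat_sum)
  qed (auto simp: cycle_dist_def)
  have card_verts: "card (verts (cycle_graph n)) = n"
    by (simp add: cycle_graph_def)
  have "distance_matrix (cycle_graph n) = mat n n (\<lambda>(i, j). ?d i j)"
    unfolding distance_matrix_def card_verts
    by (intro cong_mat) (simp_all add: graph_dist_cycle)
  then have "distance_pareto_eigenvalues (cycle_graph n) = {l. pareto l}"
    by (simp add: distance_pareto_eigenvalues_def pareto_eigenvalue_iff)
  \<comment> \<open>The values are 1 and 2. Here \<open>n \<ge> 4\<close> matters: for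
    \<open>n = 3\<close> both would be 1.\<close>
  moreover have "?d 0 1 \<noteq> ?d 0 2"
    using assms by (simp add: cycle_dist_def)
  moreover have "\<lfloor>(real n)\<^sup>2 / 4\<rfloor> = int (n\<^sup>2 div 4)"
    by (metis floor_divide_of_nat_eq of_nat_numeral of_nat_power)
  ultimately show ?thesis
    using kth_largest_pareto_gap[of 0 1 2] assms by (simp add: rho_def)
qed

end
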